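(* There is an absolute constant $C>0$ such that the following holds. Let $d\geq 1$ be an integer, let $K\geq 1$, and let $F:\mathbb{T}^d\to[0,1]$ satisfy $$|F(\alpha)-F(\beta)|\leq K\max_j\|\alpha_j-\beta_j\|_{\mathbb{T}}\qquad\text{for all }\alpha,\beta\in\mathbb{T}^d.$$ Then for every positive integer $N$, every Sidon set $S\subset[N]$ with $|S|\geq\frac{1}{100}N^{1/2}$ and every $\alpha\in\mathbb{T}^d$, $$\left|\mathbb{E}_{x\in S}F(\alpha x)-\mathbb{E}_{x\in[N]}F(\alpha x)\right|\leq C K^{\frac{2}{3}}\left(\left|\frac{|S|}{N^{1/2}}-1\right|+N^{-1/6}\right)^{\frac{1}{8d}}.$$
   Context: $[N]=\{1,2,\dots,N\}$, $\mathbb{T}=\mathbb{R}/\mathbb{Z}$, and $\|\alpha\|_{\mathbb{T}}=\min_{n\in\mathbb{Z}}|\alpha-n|$. A set $S\subset\mathbb{Z}$ is Sidon if every non-zero integer $x$ has at most one representation $x=s_1-s_2$ with $s_1,s_2\in S$. For a finite non-empty set $A$, $\mathbb{E}_{x\in A}f(x)=\frac{1}{|A|}\sum_{x\in A}f(x)$. For $\alpha=(\alpha_1,\dots,\alpha_d)\in\mathbb{T}^d$ and $x\in\mathbb{Z}$, $\alpha x=(\alpha_1x,\dots,\alpha_dx)$. *)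

theory Defs
  imports Complex_Main "HOL-Library.FuncSet"
begin

quotient_type circle = real / "\<lambda>x y :: real. x - y \<in> \<int>"
proof (rule equivpI)
  show "reflp (\<lambda>x y :: real. x - y \<in> \<int>)"
    by (simp add: reflp_def)
  show "symp (\<lambda>x y :: real. x - y \<in> \<int>)"
    unfolding symp_def by (metis Ints_minus minus_diff_eq)
  show "transp (\<lambda>x y :: real. x - y \<in> \<int>)"
    unfolding transp_def by (metis Ints_add diff_add_cancel add_diff_eq)
qed

instantiation circle :: ab_group_add
begin

lift_definition zero_circle :: circle is "0 :: real" .

lift_definition plus_circle :: "circle \<Rightarrow> circle \<Rightarrow> circle" is "(+) :: real \<Rightarrow> real \<Rightarrow> real"
  by (metis Ints_add add_diff_add)

lift_definition minus_circle :: "circle \<Rightarrow> circle \<Rightarrow> circle" is "(-) :: real \<Rightarrow> real \<Rightarrow> real"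
proof -
  fix a b c d :: real
  assume "a - b \<in> \<int>" "c - d \<in> \<int>"
  then have "(a - b) - (c - d) \<in> \<int>" by (rule Ints_diff)
  then show "(a - c) - (b - d) \<in> \<int>" by (simp add: algebra_simps)
qed

lift_definition uminus_circle :: "circle \<Rightarrow> circle" is "uminus :: real \<Rightarrow> real"
proof -
  fix a b :: real
  assume "a - b \<in> \<int>"
  then have "- (a - b) \<in> \<int>" by (rule Ints_minus)
  then show "- a - - b \<in> \<int>" by simp
qed

instance
  by standard (transfer; simp add: algebra_simps)+

end

lift_definition int_mult_circle :: "int \<Rightarrow> circle \<Rightarrow> circle" is "\<lambda>n x. of_int n * x"
proof -
  fix n :: int and a b :: real
  assume "a - b \<in> \<int>"
  then have "of_int n * (a - b) \<in> \<int>" by (intro Ints_mult Ints_of_int)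
  then show "of_int n * a - of_int n * b \<in> \<int>" by (simp add: algebra_simps)
qed

text \<open>The infimum below is a minimum; see \<open>circle_norm_attained\<close>.\<close>

lift_definition circle_norm :: "circle \<Rightarrow> real" is "\<lambda>x. INF n::int. \<bar>x - of_int n\<bar>"
proof -
  fix a b :: real
  assume "a - b \<in> \<int>"
  then obtain k where k: "a - b = of_int k" by (elim Ints_cases)
  have "range (\<lambda>n::int. \<bar>a - of_int n\<bar>) = range (\<lambda>n::int. \<bar>b - of_int n\<bar>)" (is "?A = ?B")
  proof
    show "?A \<subseteq> ?B"
    proof (intro subsetI, elim rangeE)
      fix x n assume "x = \<bar>a - of_int n\<bar>"
      then have "x = \<bar>b - of_int (n - k)\<bar>" using k by (simp add: algebra_simps)
      then show "x \<in> ?B" by blast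
    qed
    show "?B \<subseteq> ?A"
    proof (intro subsetI, elim rangeE)
      fix x n assume "x = \<bar>b - of_int n\<bar>"
      then have "x = \<bar>a - of_int (n + k)\<bar>" using k by (simp add: algebra_simps)
      then show "x \<in> ?A" by blast
    qed
  qed
  then show "(INF n::int. \<bar>a - of_int n\<bar>) = (INF n::int. \<bar>b - of_int n\<bar>)" by simp
qed

lemma circle_norm_attained:
  "(\<exists>n::int. circle_norm (abs_circle x) = \<bar>x - of_int n\<bar>) \<and>
   (\<forall>n::int. circle_norm (abs_circle x) \<le> \<bar>x - of_int n\<bar>)"
proof -
  have le: "\<bar>x - of_int (round x)\<bar> \<le> \<bar>x - of_int n\<bar>" for n :: int
    using round_diff_minimal[of x n] by simp
  have "(INF n::int. \<bar>x - of_int n\<bar>) = \<bar>x - of_int (round x)\<bar>"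
    by (rule cInf_eq_minimum) (use le in auto)
  then show ?thesis using le by (auto simp: circle_norm.abs_eq)
qed

text \<open>The dimension \<open>d\<close> has to be quantified inside the scope of the absolute constant, so
  \<open>d\<close>-tuples are extensional functions on \<open>{1..d}\<close> rather than vectors of fixed type.\<close>

definition torus :: "nat \<Rightarrow> (nat \<Rightarrow> circle) set" where
  "torus d = {1..d} \<rightarrow>\<^sub>E UNIV"

definition int_mult_torus :: "nat \<Rightarrow> int \<Rightarrow> (nat \<Rightarrow> circle) \<Rightarrow> (nat \<Rightarrow> circle)" where
  "int_mult_torus d x \<alpha> = (\<lambda>j\<in>{1..d}. int_mult_circle x (\<alpha> j))"

definition Sidon :: "int set \<Rightarrow> bool" where
  "Sidon S \<longleftrightarrow> (\<forall>x. x \<noteq> 0 \<longrightarrow>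
     (\<forall>s1\<in>S. \<forall>s2\<in>S. \<forall>t1\<in>S. \<forall>t2\<in>S. x = s1 - s2 \<and> x = t1 - t2 \<longrightarrow> s1 = t1 \<and> s2 = t2))"

definition average :: "'a set \<Rightarrow> ('a \<Rightarrow> real) \<Rightarrow> real" where
  "average A f = (\<Sum>x\<in>A. f x) / real (card A)"

end

theory Submission
  imports Defs "HOL-Analysis.Convex"
begin

text \<open>
  Let \<open>\<delta>\<close> be the quantity raised to the power \<open>1/(8d)\<close>. If \<open>H \<subseteq> [0, L)\<close> then the number
  \<open>r n\<close> of representations \<open>n = s + h\<close> with \<open>s \<in> S\<close>, \<open>h \<in> H\<close> satisfies
  \<open>\<Sum> r = |S| |H|\<close> and, by the Sidon property, \<open>\<Sum> r^2 \<le> |S| |H| + |H|^2\<close>. As \<open>|S|^2\<close> is close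
  to \<open>N\<close>, the variance of \<open>r\<close> on \<open>[N + L]\<close> is small as soon as \<open>|H|\<close> is much larger than
  \<open>sqrt N\<close> and \<open>L\<close> much smaller than \<open>N\<close>, so that \<open>S + H\<close> is equidistributed. By the pigeonhole
  principle \<open>H\<close> can be taken inside a Bohr set of radius about \<open>\<delta> powr (1/d)\<close> with \<open>L\<close> about
  \<open>\<delta> N\<close> and \<open>|H| \<ge> \<delta>^2 N\<close>; shifting by an element of \<open>H\<close> then changes \<open>F (\<alpha> x)\<close> by
  \<open>O(K \<delta> powr (1/d))\<close> only.
\<close>

section \<open>Pigeonhole and large subsets of Bohr sets\<close>

lemma pigeonhole_fibre:
  assumes "finite A" "f ` A \<subseteq> Y" "finite Y" "Y \<noteq> {}"
  obtains y where "y \<in> Y" "card A \<le> card Y * card {x \<in> A. f x = y}"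
proof -
  have "\<exists>y\<in>Y. card A \<le> card Y * card {x \<in> A. f x = y}"
  proof (rule ccontr)
    assume "\<not> ?thesis"
    then have "(\<Sum>y\<in>Y. card Y * card {x \<in> A. f x = y}) < (\<Sum>y\<in>Y. card A)"
      using assms by (intro sum_strict_mono) auto
    moreover have "(\<Sum>y\<in>Y. card {x \<in> A. f x = y}) = card A"
      using sum.group[of A Y f "\<lambda>_. 1::nat"] assms by simp
    ultimately show False
      by (simp flip: sum_distrib_left)
  qed
  then show thesis using that by blast
qed

lemma circle_norm_le:
  "circle_norm (abs_circle x) \<le> \<bar>x - of_int n\<bar>"
  using circle_norm_attained by blast

lemma int_mult_circle_add:
  "int_mult_circle (m + n) a - int_mult_circle m a = int_mult_circle n a"
  by transfer (simp add: algebra_simps)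

text \<open>Fractional parts in the same one of \<open>q\<close> equal cells of
  \<open>[0, 1)\<close> are less than \<open>1 / q\<close> apart, and the difference of the two
  floors is an integer witnessing the bound on the norm.\<close>

lemma circle_norm_int_mult_diff_le:
  fixes q :: nat
  assumes "\<lfloor>real q * frac (of_int m * x)\<rfloor> = \<lfloor>real q * frac (of_int n * x)\<rfloor>" "q > 0"
  shows "circle_norm (int_mult_circle (m - n) (abs_circle x)) \<le> 1 / q"
proof -
  define u v where "u = frac (of_int m * x)" and "v = frac (of_int n * x)"
  have "\<bar>real q * u - real q * v\<bar> < 1"
    using assms(1) unfolding u_def[symmetric] v_def[symmetric]
    by linarith
  then have "q * \<bar>u - v\<bar> < 1"
    by (simp flip: right_diff_distrib add: abs_mult)
  then have uv: "\<bar>u - v\<bar> \<le> 1 / q"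
    using assms(2) by (simp add: field_simps)
  have "circle_norm (int_mult_circle (m - n) (abs_circle x))
      \<le> \<bar>of_int (m - n) * x - of_int (\<lfloor>of_int m * x\<rfloor> - \<lfloor>of_int n * x\<rfloor>)\<bar>"
    unfolding int_mult_circle.abs_eq by (rule circle_norm_le)
  also have "\<dots> = \<bar>u - v\<bar>"
    by (simp add: u_def v_def frac_def algebra_simps)
  finally show ?thesis using uv by simp
qed

text \<open>The torus is cut into \<open>q ^ d\<close> boxes. Some box receives at least the average
  share of the multiples of \<alpha>, and differences of integers from one box lie in the Bohr
  set.\<close>

lemma exists_large_Bohr_subset:
  fixes q L d :: nat and \<alpha> :: "nat \<Rightarrow> circle"
  assumes "q > 0" "L > 0"
  obtains H :: "int set" where "H \<subseteq> {0..<int L}" "L \<le> q ^ d * card H"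
    "\<And>h j. h \<in> H \<Longrightarrow> j \<in> {1..d} \<Longrightarrow> circle_norm (int_mult_circle h (\<alpha> j)) \<le> 1 / q"
proof -
  define box where
    "box = (\<lambda>h::int. \<lambda>j\<in>{1..d}. \<lfloor>real q * frac (of_int h * rep_circle (\<alpha> j))\<rfloor>)"
  define Y where "Y = ({1..d} \<rightarrow>\<^sub>E {0..<int q})"
  have sub: "box ` {0..<int L} \<subseteq> Y"
  proof -
    have "\<lfloor>real q * frac t\<rfloor> \<in> {0..<int q}" for t
    proof -
      have "real q * frac t < real q * 1"
        using assms frac_lt_1[of t] by (intro mult_strict_left_mono) auto
      then have "\<lfloor>real q * frac t\<rfloor> < int q"
        by (simp add: floor_less_iff)
      moreover have "0 \<le> real q * frac t" by (simp add: frac_ge_0)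
      ultimately show ?thesis by simp
    qed
    then show ?thesis unfolding box_def Y_def by auto
  qed
  have cardY: "card Y = q ^ d"
    by (simp add: Y_def card_PiE)
  have finY: "finite Y" unfolding Y_def by (intro finite_PiE) auto
  have "Y \<noteq> {}" using cardY assms by auto
  then obtain y where y: "card {0..<int L} \<le> card Y * card {h \<in> {0..<int L}. box h = y}"
    using pigeonhole_fibre[OF _ sub finY] by auto
  define B where "B = {h \<in> {0..<int L}. box h = y}"
  have finB: "finite B"
    by (rule finite_subset[of _ "{0..<int L}"]) (auto simp: B_def)
  have B: "L \<le> q ^ d * card B" using y by (simp add: B_def cardY)
  then have "B \<noteq> {}" using assms by auto
  \<comment> \<open>Subtracting the least element turns members of the box into differences while
    keeping them in \<open>{0..<int L}\<close>.\<close>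
  define b where "b = Min B"
  have bB: "b \<in> B" and bmin: "\<And>h. h \<in> B \<Longrightarrow> b \<le> h"
    using finB \<open>B \<noteq> {}\<close> by (auto simp: b_def)
  show thesis
  proof
    show "(\<lambda>h. h - b) ` B \<subseteq> {0..<int L}"
      using bB bmin by (auto simp: B_def)
    show "L \<le> q ^ d * card ((\<lambda>h. h - b) ` B)"
      using B by (subst card_image) (auto simp: inj_on_def)
    fix h j assume h: "h \<in> (\<lambda>h. h - b) ` B" and j: "j \<in> {1..d}"
    then obtain h' where h': "h' \<in> B" "h = h' - b" by auto
    have "box h' j = box b j" using h' bB by (simp add: B_def)
    then have "\<lfloor>real q * frac (of_int h' * rep_circle (\<alpha> j))\<rfloor>
        = \<lfloor>real q * frac (of_int b * rep_circle (\<alpha> j))\<rfloor>"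
      using j by (simp add: box_def)
    from circle_norm_int_mult_diff_le[OF this assms(1)]
    show "circle_norm (int_mult_circle h (\<alpha> j)) \<le> 1 / q"
      using h'(2) Quotient3_abs_rep[OF Quotient3_circle] by simp
  qed
qed

section \<open>Representation counts and their second moment\<close>

text \<open>This is \<open>r\<close> of the overview, written as a real sum of indicators so that
  weighted sums of it reduce to exchanging the order of summation.\<close>

definition rep_count :: "int set \<Rightarrow> int set \<Rightarrow> int \<Rightarrow> real" where
  "rep_count S H n = (\<Sum>s\<in>S. \<Sum>h\<in>H. if s + h = n then 1 else 0)"

text \<open>Applied with three weights: \<open>1\<close> for the total mass,
  \<open>rep_count\<close> itself for the second moment, and the test function for its average over
  \<open>S + H\<close>.\<close>

lemma sum_rep_count_mult:
  assumes "finite T" "\<And>s h. s \<in> S \<Longrightarrow> h \<in> H \<Longrightarrow> s + h \<in> T"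
  shows "(\<Sum>n\<in>T. rep_count S H n * g n) = (\<Sum>s\<in>S. \<Sum>h\<in>H. g (s + h))"
proof -
  have "(\<Sum>n\<in>T. rep_count S H n * g n)
      = (\<Sum>n\<in>T. \<Sum>s\<in>S. \<Sum>h\<in>H. if s + h = n then g n else 0)"
    unfolding rep_count_def sum_distrib_right by (intro sum.cong) auto
  also have "\<dots> = (\<Sum>s\<in>S. \<Sum>n\<in>T. \<Sum>h\<in>H. if s + h = n then g n else 0)"
    by (rule sum.swap)
  also have "\<dots> = (\<Sum>s\<in>S. \<Sum>h\<in>H. \<Sum>n\<in>T. if s + h = n then g n else 0)"
    by (rule sum.cong[OF refl], rule sum.swap)
  also have "\<dots> = (\<Sum>s\<in>S. \<Sum>h\<in>H. g (s + h))"
    using assms by (intro sum.cong) auto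
  finally show ?thesis .
qed

lemma Sidon_card_le_one:
  assumes "Sidon S" "x \<noteq> 0"
  shows "card {p \<in> S \<times> S. fst p - snd p = x} \<le> 1"
proof (rule ccontr)
  let ?P = "{p \<in> S \<times> S. fst p - snd p = x}"
  assume *: "\<not> card ?P \<le> 1"
  \<comment> \<open>An infinite set has \<open>card\<close> equal to 0, so exceeding 1 forces
    finiteness.\<close>
  then have fin: "finite ?P" by (intro card_ge_0_finite) linarith
  have "\<not> (\<forall>p\<in>?P. \<forall>p'\<in>?P. p = p')"
    using * unfolding One_nat_def card_le_Suc0_iff_eq[OF fin] .
  then obtain s1 s2 t1 t2 where "s1 \<in> S" "s2 \<in> S" "t1 \<in> S" "t2 \<in> S"
    "x = s1 - s2" "x = t1 - t2" "(s1, s2) \<noteq> (t1, t2)"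
    by auto
  moreover from this have "s1 = t1 \<and> s2 = t2"
    using assms unfolding Sidon_def by metis
  ultimately show False by simp
qed

text \<open>The second moment counts solutions of \<open>t + k = s + h\<close>, that is
  \<open>t - s = h - k\<close>. Each pair with \<open>h = k\<close> allows \<open>card S\<close>
  choices of \<open>(t, s)\<close>; by the Sidon property every other pair allows at most
  one.\<close>

lemma sum_rep_count_squared_le:
  assumes "Sidon S" "finite S" "finite H" "finite T"
    "\<And>s h. s \<in> S \<Longrightarrow> h \<in> H \<Longrightarrow> s + h \<in> T"
  shows "(\<Sum>n\<in>T. (rep_count S H n)\<^sup>2) \<le> real (card S) * card H + (card H)\<^sup>2"
proof -
  let ?D = "\<lambda>x. {p \<in> S \<times> S. fst p - snd p = x}"
  have "(\<Sum>n\<in>T. (rep_count S H n)\<^sup>2) = (\<Sum>s\<in>S. \<Sum>h\<in>H. rep_count S H (s + h))"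
    using sum_rep_count_mult[OF assms(4,5), where g = "rep_count S H"]
    by (simp add: power2_eq_square)
  also have "\<dots> = (\<Sum>h\<in>H. \<Sum>s\<in>S. rep_count S H (s + h))"
    by (rule sum.swap)
  also have "\<dots> = (\<Sum>h\<in>H. \<Sum>k\<in>H. real (card (?D (h - k))))"
  proof (rule sum.cong[OF refl])
    fix h
    have "(\<Sum>s\<in>S. rep_count S H (s + h))
        = (\<Sum>s\<in>S. \<Sum>k\<in>H. \<Sum>t\<in>S. if t + k = s + h then 1 else 0)"
      unfolding rep_count_def by (rule sum.cong[OF refl], rule sum.swap)
    also have "\<dots> = (\<Sum>k\<in>H. \<Sum>s\<in>S. \<Sum>t\<in>S. if t + k = s + h then 1 else 0)"
      by (rule sum.swap)
    also have "\<dots> = (\<Sum>k\<in>H. real (card (?D (h - k))))"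
    proof (rule sum.cong[OF refl])
      fix k
      \<comment> \<open>The swap makes \<open>t\<close> the first component of the pair, matching
        \<open>t - s = h - k\<close>.\<close>
      have "(\<Sum>s\<in>S. \<Sum>t\<in>S. if t + k = s + h then 1 else 0)
          = (\<Sum>t\<in>S. \<Sum>s\<in>S. if t + k = s + h then 1 else (0::real))"
        by (rule sum.swap)
      also have "\<dots> = (\<Sum>p\<in>S \<times> S. if fst p - snd p = h - k then 1 else (0::real))"
        unfolding sum.cartesian_product by (intro sum.cong) auto
      also have "\<dots> = real (card (?D (h - k)))"
        using assms(2) by (simp flip: sum.inter_filter)
      finally show "(\<Sum>s\<in>S. \<Sum>t\<in>S. if t + k = s + h then 1 else 0)
          = real (card (?D (h - k)))" .
    qed
    finally show "(\<Sum>s\<in>S. rep_count S H (s + h)) = (\<Sum>k\<in>H. real (card (?D (h - k))))" .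
  qed
  also have "\<dots> \<le> (\<Sum>h\<in>H. \<Sum>k\<in>H. (if h = k then real (card S) else 0) + 1)"
  proof (intro sum_mono)
    fix h k
    show "real (card (?D (h - k))) \<le> (if h = k then real (card S) else 0) + 1"
    proof (cases "h = k")
      case True
      have "?D 0 = (\<lambda>s. (s, s)) ` S" by auto
      then have "card (?D 0) = card S" by (simp add: card_image inj_on_def)
      then show ?thesis using True by simp
    next
      case False
      then show ?thesis using Sidon_card_le_one[OF assms(1), of "h - k"] by simp
    qed
  qed
  also have "\<dots> = real (card S) * card H + (card H)\<^sup>2"
    using assms(3) by (simp add: sum.distrib power2_eq_square algebra_simps)
  finally show ?thesis by simp
qed

section \<open>Comparing averages over the Sidon set and the interval\<close>

lemma average_extend_interval:
  fixes N L :: nat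
  assumes "N > 0" "\<And>n. g n \<in> {0..1::real}"
  shows "\<bar>average {1..int (N + L)} g - average {1..int N} g\<bar> \<le> L / N"
proof -
  define A where "A = (\<Sum>x\<in>{1..int N}. g x)"
  define B where "B = (\<Sum>x\<in>{int N + 1..int (N + L)}. g x)"
  have "{1..int (N + L)} = {1..int N} \<union> {int N + 1..int (N + L)}" by auto
  then have AB: "(\<Sum>x\<in>{1..int (N + L)}. g x) = A + B"
    unfolding A_def B_def by (simp add: sum.union_disjoint)
  have A: "0 \<le> A" "A \<le> N"
    using sum_bounded_above[of "{1..int N}" g 1] assms(2)
    by (auto simp: A_def intro: sum_nonneg)
  have B: "0 \<le> B" "B \<le> L"
    using sum_bounded_above[of "{int N + 1..int (N + L)}" g 1] assms(2)
    by (auto simp: B_def intro: sum_nonneg)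
  \<comment> \<open>Both \<open>N * B\<close> and \<open>L * A\<close> lie between 0 and
    \<open>N * L\<close>, so their difference is at most \<open>N * L\<close> in absolute
    value.\<close>
  have "(A + B) / (N + L) - A / N = (N * B - L * A) / (N * (real N + L))"
    using assms(1) by (simp add: field_simps)
  moreover have "\<bar>N * B - L * A\<bar> \<le> real N * L"
  proof -
    have "N * B \<le> real N * L" "L * A \<le> real L * N" "0 \<le> N * B" "0 \<le> L * A"
      using A B by (auto intro: mult_left_mono)
    then show ?thesis by (simp add: mult.commute abs_le_iff)
  qed
  ultimately have "\<bar>(A + B) / (N + L) - A / N\<bar> \<le> (real N * L) / (N * (real N + L))"
    using divide_right_mono[of "\<bar>N * B - L * A\<bar>" "real N * L" "N * (real N + L)"]
    by (simp only: abs_divide) simp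
  also have "\<dots> = L / (real N + L)" using assms(1) by simp
  also have "\<dots> \<le> L / N" using assms(1) by (intro divide_left_mono) auto
  finally show ?thesis
    unfolding average_def AB A_def[symmetric] by simp
qed

text \<open>Three replacements give the three errors: \<open>g s\<close> by \<open>g (s + h)\<close>
  costs \<epsilon>; the weight \<open>rep_count\<close> by its mean on
  \<open>{1..int (N + L)}\<close> costs the square root, by Cauchy-Schwarz and the variance bound;
  shrinking that interval to \<open>{1..int N}\<close> costs \<open>L / N\<close>.\<close>

lemma Sidon_average_near_shift_invariant:
  fixes S H :: "int set" and N L :: nat and g :: "int \<Rightarrow> real"
  assumes S: "Sidon S" "S \<subseteq> {1..int N}" "S \<noteq> {}"
    and H: "H \<subseteq> {0..<int L}" "H \<noteq> {}"
    and N: "N > 0"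
    and g: "\<And>n. g n \<in> {0..1}"
    and shift: "\<And>n h. h \<in> H \<Longrightarrow> \<bar>g (n + h) - g n\<bar> \<le> \<epsilon>"
  shows "\<bar>average S g - average {1..int N} g\<bar>
    \<le> \<epsilon> + L / N + sqrt ((N + L) / (real (card S) * card H) + (N + L) / (card S)\<^sup>2 - 1)"
proof -
  define T where "T = {1..int (N + L)}"
  define a b t where "a = real (card S)" and "b = real (card H)" and "t = real (card T)"
  \<comment> \<open>The mean of \<open>?r\<close> on \<open>T\<close>, since the total mass is
    \<open>a * b\<close>.\<close>
  define \<mu> where "\<mu> = a * b / t"
  let ?r = "rep_count S H"
  have finS: "finite S" and finH: "finite H" and finT: "finite T"
    using S(2) H(1) by (auto simp: T_def intro: finite_subset)
  have pos: "a > 0" "b > 0" "t > 0"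
    using finS finH S(3) H(2) N by (auto simp: a_def b_def t_def T_def card_gt_0_iff)
  have tN: "t = N + L" by (simp add: t_def T_def)
  have ST: "s + h \<in> T" if "s \<in> S" "h \<in> H" for s h
    using that S(2) H(1) unfolding T_def by fastforce
  have sum_r: "(\<Sum>n\<in>T. ?r n) = a * b"
    using sum_rep_count_mult[OF finT ST, where g = "\<lambda>_. 1"] by (simp add: a_def b_def)
  have "(\<Sum>n\<in>T. (?r n - \<mu>)\<^sup>2) = (\<Sum>n\<in>T. (?r n)\<^sup>2) - 2 * \<mu> * (\<Sum>n\<in>T. ?r n) + t * \<mu>\<^sup>2"
    by (simp add: power2_diff sum.distrib sum_subtractf sum_distrib_left sum_distrib_right
        t_def mult_ac)
  also have "\<dots> = (\<Sum>n\<in>T. (?r n)\<^sup>2) - a\<^sup>2 * b\<^sup>2 / t"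
    using pos by (simp add: sum_r \<mu>_def power2_eq_square field_simps)
  also have "\<dots> \<le> a * b + b\<^sup>2 - a\<^sup>2 * b\<^sup>2 / t"
    using sum_rep_count_squared_le[OF S(1) finS finH finT ST] by (simp add: a_def b_def)
  finally have var: "(\<Sum>n\<in>T. (?r n - \<mu>)\<^sup>2) \<le> a * b + b\<^sup>2 - a\<^sup>2 * b\<^sup>2 / t" .
  \<comment> \<open>Monotonicity of the product after Cauchy-Schwarz requires this upper bound to be
    nonnegative.\<close>
  have var0: "0 \<le> a * b + b\<^sup>2 - a\<^sup>2 * b\<^sup>2 / t"
    using sum_nonneg[of T "\<lambda>n. (?r n - \<mu>)\<^sup>2"] var by simp
  have "(\<Sum>n\<in>T. (?r n - \<mu>) * g n)\<^sup>2 \<le> (\<Sum>n\<in>T. (?r n - \<mu>)\<^sup>2) * (\<Sum>n\<in>T. (g n)\<^sup>2)"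
    by (rule Cauchy_Schwarz_ineq_sum)
  also have "\<dots> \<le> (a * b + b\<^sup>2 - a\<^sup>2 * b\<^sup>2 / t) * t"
  proof (intro mult_mono var var0 sum_nonneg)
    have "(g n)\<^sup>2 \<le> 1" for n using g[of n] by (simp add: power_le_one)
    then show "(\<Sum>n\<in>T. (g n)\<^sup>2) \<le> t"
      using sum_bounded_above[of T "\<lambda>n. (g n)\<^sup>2" 1] by (simp add: t_def)
  qed auto
  also have "\<dots> = (a * b)\<^sup>2 * (t / (a * b) + t / a\<^sup>2 - 1)"
    using pos by (simp add: power2_eq_square field_simps)
  finally have "\<bar>\<Sum>n\<in>T. (?r n - \<mu>) * g n\<bar> \<le> sqrt ((a * b)\<^sup>2 * (t / (a * b) + t / a\<^sup>2 - 1))"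
    by (metis real_sqrt_abs real_sqrt_le_mono)
  then have var': "\<bar>\<Sum>n\<in>T. (?r n - \<mu>) * g n\<bar> \<le> a * b * sqrt (t / (a * b) + t / a\<^sup>2 - 1)"
    using pos by (simp add: real_sqrt_mult)
  have "(\<Sum>n\<in>T. \<mu> * g n) = a * b * average T g"
    by (simp add: average_def \<mu>_def t_def sum_distrib_left sum_divide_distrib)
  then have split: "(\<Sum>n\<in>T. (?r n - \<mu>) * g n)
      = (\<Sum>s\<in>S. \<Sum>h\<in>H. g (s + h)) - a * b * average T g"
    using sum_rep_count_mult[of T S H g, OF finT ST] by (simp add: left_diff_distrib sum_subtractf)
  have "(\<Sum>s\<in>S. \<Sum>h\<in>H. g (s + h)) - a * b * average S g = (\<Sum>s\<in>S. \<Sum>h\<in>H. g (s + h) - g s)"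
    using pos by (simp add: sum_subtractf average_def a_def b_def flip: sum_distrib_left)
  moreover have "\<bar>\<Sum>s\<in>S. \<Sum>h\<in>H. g (s + h) - g s\<bar> \<le> (\<Sum>s\<in>S. \<Sum>h\<in>H. \<epsilon>)"
    by (intro order.trans[OF sum_abs] sum_mono) (use shift in auto)
  ultimately have near: "\<bar>(\<Sum>s\<in>S. \<Sum>h\<in>H. g (s + h)) - a * b * average S g\<bar> \<le> a * b * \<epsilon>"
    by (simp add: a_def b_def)
  have "a * b * \<bar>average S g - average T g\<bar> = \<bar>a * b * average S g - a * b * average T g\<bar>"
    using pos by (simp add: abs_mult flip: right_diff_distrib)
  also have "\<dots> \<le> a * b * (\<epsilon> + sqrt (t / (a * b) + t / a\<^sup>2 - 1))"
    using var' near unfolding split by (simp add: distrib_left)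
  finally have "\<bar>average S g - average T g\<bar> \<le> \<epsilon> + sqrt (t / (a * b) + t / a\<^sup>2 - 1)"
    using pos by simp
  moreover have "\<bar>average T g - average {1..int N} g\<bar> \<le> L / N"
    unfolding T_def by (rule average_extend_interval[OF N g])
  ultimately show ?thesis by (simp add: a_def b_def tN)
qed

section \<open>Choice of parameters and the final estimate\<close>

lemma average_mem_01:
  assumes "\<And>x. g x \<in> {0..1::real}"
  shows "average A g \<in> {0..1}"
proof -
  have "0 \<le> sum g A" "sum g A \<le> card A"
    using assms sum_bounded_above[of A g 1] by (auto intro: sum_nonneg)
  \<comment> \<open>For an empty or infinite \<open>A\<close> the quotient is \<open>0 / 0\<close>,
    which is 0.\<close>
  then show ?thesis unfolding average_def by (auto simp: divide_le_eq)
qed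

text \<open>The preceding estimate is optimised: \<open>L\<close> near \<open>\<delta> * N\<close>
  keeps \<open>L / N\<close> of order \<delta>, and \<open>q ^ d\<close> at most
  \<open>1 / \<delta>\<close> leaves \<open>H\<close> with at least
  \<open>\<delta>\<^sup>2 * N\<close> elements while its Bohr radius is at most
  \<open>2 * \<delta> powr (1 / d)\<close>.\<close>

lemma Sidon_Lipschitz_average:
  fixes \<delta> :: real
  assumes d: "d \<ge> 1" and K: "K \<ge> 1"
    and F: "F \<in> torus d \<rightarrow> {0..1::real}"
    and Lip: "\<forall>\<alpha>\<in>torus d. \<forall>\<beta>\<in>torus d.
         \<bar>F \<alpha> - F \<beta>\<bar> \<le> K * (MAX j\<in>{1..d}. circle_norm (\<alpha> j - \<beta> j))"
    and N: "N > 0" and S: "S \<subseteq> {1..int N}" "Sidon S"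
    and \<delta>: "\<delta> = \<bar>card S / sqrt N - 1\<bar> + N powr (-1/6)" "\<delta> \<le> 1 / 2"
  shows "\<bar>average S (\<lambda>x. F (int_mult_torus d x \<alpha>)) -
           average {1..int N} (\<lambda>x. F (int_mult_torus d x \<alpha>))\<bar>
    \<le> 2 * (K * \<delta> powr (1 / d)) + 7 * sqrt \<delta>"
proof -
  define g where "g = (\<lambda>x. F (int_mult_torus d x \<alpha>))"
  define L where "L = nat \<lceil>\<delta> * N\<rceil>"
  define q where "q = nat \<lfloor>\<delta> powr (- 1 / d)\<rfloor>"
  define s where "s = card S / sqrt N"
  have torus: "int_mult_torus d x \<alpha> \<in> torus d" for x
    by (auto simp: int_mult_torus_def torus_def)
  have g: "g n \<in> {0..1}" for n
    unfolding g_def by (rule funcset_mem[OF F torus])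
  have N1: "real N \<ge> 1" using N by simp
  have \<delta>N: "N powr (-1/6) \<le> \<delta>" using \<delta>(1) by simp
  have \<delta>0: "\<delta> > 0" using N1 by (intro less_le_trans[OF _ \<delta>N]) simp
  have s: "\<bar>s - 1\<bar> \<le> \<delta>" using \<delta>(1) by (simp add: s_def)
  then have s2: "s \<ge> 1 / 2" using \<delta>(2) by linarith
  have cS: "card S = s * sqrt N" using N1 by (simp add: s_def)
  then have "S \<noteq> {}" using s2 N1 by auto

  have "\<delta> powr (1 / d) \<le> 1" using \<delta> \<delta>0 by (intro powr_le1) auto
  then have inv1: "\<delta> powr (- 1 / d) \<ge> 1"
    using \<delta>0 by (simp add: powr_minus field_simps)
  have q0: "q > 0" unfolding q_def using inv1 by (simp add: le_nat_iff le_floor_iff)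
  have qle: "real q \<le> \<delta> powr (- 1 / d)" unfolding q_def using inv1 by simp
  have qge: "\<delta> powr (- 1 / d) \<le> 2 * real q"
  proof -
    have "\<delta> powr (- 1 / d) < real q + 1" unfolding q_def using inv1 by linarith
    moreover have "real q \<ge> 1" using q0 by simp
    ultimately show ?thesis by linarith
  qed
  have qinv: "1 / real q \<le> 2 * \<delta> powr (1 / d)"
    using qge q0 \<delta>0 by (simp add: powr_minus field_simps)
  have "real q ^ d \<le> (\<delta> powr (- 1 / d)) ^ d" by (rule power_mono[OF qle]) simp
  also have "\<dots> = 1 / \<delta>"
    using d \<delta>0 by (simp add: powr_power powr_minus field_simps)
  finally have qd: "real q ^ d \<le> 1 / \<delta>" .

  \<comment> \<open>The term \<open>N powr (-1/6)\<close> in \<delta> is there for this: it makes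
    \<open>\<delta>\<^sup>2 * N\<close> at least \<open>sqrt N / \<delta>\<close>, so
    \<open>H\<close> is much larger than \<open>sqrt N\<close>.\<close>
  have third: "1 \<le> \<delta> ^ 3 * sqrt N"
  proof -
    have "(N powr (-1/6)) ^ 3 \<le> \<delta> ^ 3" by (rule power_mono[OF \<delta>N]) simp
    moreover have "(N powr (-1/6)) ^ 3 = 1 / sqrt N"
      using N1 by (simp add: powr_power powr_minus powr_half_sqrt field_simps)
    ultimately show ?thesis
      using N1 mult_right_mono[of "1 / sqrt N" "\<delta> ^ 3" "sqrt N"] by simp
  qed
  \<comment> \<open>Ensures that rounding \<open>\<delta> * N\<close> up to \<open>L\<close> at most
    doubles it.\<close>
  have N\<delta>: "1 \<le> \<delta> * N"
  proof -
    have "\<delta> ^ 3 * sqrt N \<le> \<delta> * N"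
    proof (rule mult_mono)
      show "\<delta> ^ 3 \<le> \<delta>" using \<delta> \<delta>0 power_decreasing[of 1 3 \<delta>] by simp
      show "sqrt N \<le> N" using N1 by (simp add: real_le_lsqrt power2_eq_square)
    qed (use \<delta>0 in auto)
    then show ?thesis using third by simp
  qed
  have L: "\<delta> * N \<le> L" "L \<le> 2 * \<delta> * N"
    unfolding L_def using N\<delta> by linarith+
  have L0: "L > 0" using L N\<delta> by simp
  have LN: "L \<le> N"
  proof -
    have "2 * \<delta> * N \<le> 1 * real N" using \<delta>(2) by (intro mult_right_mono) auto
    then show ?thesis using L(2) by linarith
  qed

  obtain H :: "int set" where H: "H \<subseteq> {0..<int L}" "L \<le> q ^ d * card H"
    "\<And>h j. h \<in> H \<Longrightarrow> j \<in> {1..d} \<Longrightarrow> circle_norm (int_mult_circle h (\<alpha> j)) \<le> 1 / q"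
    using exists_large_Bohr_subset[OF q0 L0] by metis
  have "H \<noteq> {}" using H(2) L0 by auto
  have cH: "\<delta>\<^sup>2 * N \<le> card H"
  proof -
    have "\<delta> * N \<le> real (q ^ d * card H)" using L(1) H(2) by linarith
    also have "\<dots> \<le> 1 / \<delta> * card H" using mult_right_mono[OF qd, of "card H"] by simp
    finally show ?thesis using \<delta>0 by (simp add: field_simps power2_eq_square)
  qed
  have shift: "\<bar>g (n + h) - g n\<bar> \<le> 2 * (K * \<delta> powr (1 / d))" if "h \<in> H" for n h
  proof -
    have "\<bar>g (n + h) - g n\<bar> \<le> K * (MAX j\<in>{1..d}.
        circle_norm (int_mult_torus d (n + h) \<alpha> j - int_mult_torus d n \<alpha> j))"
      unfolding g_def using Lip torus by blast
    also have "\<dots> \<le> K * (2 * \<delta> powr (1 / d))"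
    proof (intro mult_left_mono)
      show "(MAX j\<in>{1..d}. circle_norm (int_mult_torus d (n + h) \<alpha> j - int_mult_torus d n \<alpha> j))
          \<le> 2 * \<delta> powr (1 / d)"
        using d order_trans[OF H(3)[OF that] qinv]
        by (auto simp: int_mult_torus_def int_mult_circle_add)
    qed (use K in simp)
    finally show ?thesis by simp
  qed
  have bound: "\<bar>average S g - average {1..int N} g\<bar> \<le> 2 * (K * \<delta> powr (1 / d)) + L / N
      + sqrt ((N + L) / (real (card S) * card H) + (N + L) / (card S)\<^sup>2 - 1)"
    by (rule Sidon_average_near_shift_invariant[OF S(2,1) \<open>S \<noteq> {}\<close> H(1) \<open>H \<noteq> {}\<close> N g shift])

  have "(N + L) / (real (card S) * card H) \<le> (2 * N) / ((1 / 2 * sqrt N) * (\<delta>\<^sup>2 * N))"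
  proof (rule frac_le)
    show "(1 / 2 * sqrt N) * (\<delta>\<^sup>2 * N) \<le> real (card S) * card H"
      unfolding cS using s2 cH by (intro mult_mono) auto
  qed (use LN N1 \<delta>0 in auto)
  also have "\<dots> = 4 / (\<delta>\<^sup>2 * sqrt N)" using N1 \<delta>0 by (simp add: field_simps)
  also have "\<dots> \<le> 4 * \<delta>"
    using third N1 \<delta>0 by (simp add: field_simps power2_eq_square power3_eq_cube)
  finally have e1: "(N + L) / (real (card S) * card H) \<le> 4 * \<delta>" .
  \<comment> \<open>As \<open>N / (card S)\<^sup>2 = 1 / s\<^sup>2\<close>, this factors
    \<open>1 - s\<close> out of \<open>1 / s\<^sup>2 - 1\<close>, and
    \<open>\<bar>1 - s\<bar>\<close> is at most \<delta>.\<close>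
  have "(N + L) / (card S)\<^sup>2 - 1 = (1 - s) * (1 / s\<^sup>2 + 1 / s) + L / N / s\<^sup>2"
    unfolding of_nat_power cS using N1 s2
    by (simp add: power_mult_distrib) (simp add: field_simps power2_eq_square)
  also have "\<dots> \<le> \<delta> * 6 + 2 * \<delta> * 4"
  proof (intro add_mono)
    have "1 / s \<le> 2" using s2 by (simp add: field_simps)
    then have "(1 / s)\<^sup>2 \<le> 2\<^sup>2" using s2 by (intro power_mono) auto
    then have s4: "1 / s\<^sup>2 \<le> 4" by (simp add: power_divide)
    have "(1 - s) * (1 / s\<^sup>2 + 1 / s) \<le> \<delta> * (1 / s\<^sup>2 + 1 / s)"
      using s s2 by (intro mult_right_mono) auto
    also have "\<dots> \<le> \<delta> * 6" using s4 \<open>1 / s \<le> 2\<close> \<delta>0 by (intro mult_left_mono) auto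
    finally show "(1 - s) * (1 / s\<^sup>2 + 1 / s) \<le> \<delta> * 6" .
    have "L / N * (1 / s\<^sup>2) \<le> 2 * \<delta> * 4"
      using L(2) s4 N1 \<delta>0 s2 by (intro mult_mono) (auto simp: field_simps)
    then show "L / N / s\<^sup>2 \<le> 2 * \<delta> * 4" by simp
  qed
  \<comment> \<open>The contributions 4, 6 and 8 add up to \<open>18 * \<delta>\<close>, rounded up
    to a coefficient with an integer square root.\<close>
  finally have "sqrt ((N + L) / (real (card S) * card H) + (N + L) / (card S)\<^sup>2 - 1)
      \<le> sqrt (25 * \<delta>)"
    using e1 \<delta>0 by (intro real_sqrt_le_mono) simp
  also have "\<dots> = 5 * sqrt \<delta>" by (simp add: real_sqrt_mult)
  finally have e2: "sqrt ((N + L) / (real (card S) * card H) + (N + L) / (card S)\<^sup>2 - 1)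
      \<le> 5 * sqrt \<delta>" .
  have "L / N \<le> 2 * \<delta>" using L(2) N1 by (simp add: field_simps)
  also have "\<delta> \<le> sqrt \<delta>" using \<delta> \<delta>0 by (simp add: real_le_rsqrt power2_eq_square mult_left_le)
  finally have "L / N \<le> 2 * sqrt \<delta>" by simp
  with bound e2 show ?thesis unfolding g_def by linarith
qed

theorem corollary1p7:
  "\<exists>C::real. C > 0 \<and>
    (\<forall>(d::nat) (K::real) (F :: (nat \<Rightarrow> circle) \<Rightarrow> real).
      d \<ge> 1 \<longrightarrow> K \<ge> 1 \<longrightarrow> F \<in> torus d \<rightarrow> {0..1} \<longrightarrow>
      (\<forall>\<alpha>\<in>torus d. \<forall>\<beta>\<in>torus d.
         \<bar>F \<alpha> - F \<beta>\<bar> \<le> K * (MAX j\<in>{1..d}. circle_norm (\<alpha> j - \<beta> j))) \<longrightarrow>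
      (\<forall>(N::nat) (S::int set). \<forall>\<alpha>\<in>torus d.
         N > 0 \<longrightarrow> S \<subseteq> {1..int N} \<longrightarrow> Sidon S \<longrightarrow>
         real (card S) \<ge> 1 / 100 * real N powr (1 / 2) \<longrightarrow>
         \<bar>average S (\<lambda>x. F (int_mult_torus d x \<alpha>)) -
           average {1..int N} (\<lambda>x. F (int_mult_torus d x \<alpha>))\<bar>
         \<le> C * K powr (2 / 3) *
             (\<bar>real (card S) / real N powr (1 / 2) - 1\<bar> + real N powr (- 1 / 6))
               powr (1 / (8 * real d))))"
\<comment> \<open>The constant is 2 + 7, the sum of the coefficients in
  \<open>Sidon_Lipschitz_average\<close>.\<close>
proof (intro exI[of _ 9] conjI allI impI ballI)
  show "(0::real) < 9" by simp
  fix d :: nat and K :: real and F :: "(nat \<Rightarrow> circle) \<Rightarrow> real"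
    and N :: nat and S :: "int set" and \<alpha> :: "nat \<Rightarrow> circle"
  assume d: "d \<ge> 1" and K: "K \<ge> 1" and F: "F \<in> torus d \<rightarrow> {0..1}"
    and Lip: "\<forall>\<alpha>\<in>torus d. \<forall>\<beta>\<in>torus d.
         \<bar>F \<alpha> - F \<beta>\<bar> \<le> K * (MAX j\<in>{1..d}. circle_norm (\<alpha> j - \<beta> j))"
    and N: "N > 0" and S: "S \<subseteq> {1..int N}" "Sidon S"
  define \<delta> where "\<delta> = \<bar>real (card S) / real N powr (1 / 2) - 1\<bar> + real N powr (- 1 / 6)"
  let ?E = "\<bar>average S (\<lambda>x. F (int_mult_torus d x \<alpha>)) -
           average {1..int N} (\<lambda>x. F (int_mult_torus d x \<alpha>))\<bar>"
  let ?R = "K powr (2 / 3) * \<delta> powr (1 / (8 * real d))"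
  have "F (int_mult_torus d x \<alpha>) \<in> {0..1}" for x
    by (rule funcset_mem[OF F]) (auto simp: int_mult_torus_def torus_def)
  from average_mem_01[of "\<lambda>x. F (int_mult_torus d x \<alpha>)", OF this]
  have triv: "?E \<le> 1" by (smt (verit) atLeastAtMost_iff)
  have \<delta>0: "\<delta> > 0" using N by (simp add: \<delta>_def add_nonneg_pos)
  have K1: "K powr (2 / 3) \<ge> 1" using K by (simp add: ge_one_powr_ge_zero)
  have "?E \<le> 9 * ?R"
  proof (cases "\<delta> \<le> 1 / 2")
    case False
    \<comment> \<open>For large \<delta> the trivial bound suffices: the exponent is at most 1, so
      the right-hand power is at least 1/2.\<close>
    have "1 / 2 \<le> (1 / 2 :: real) powr (1 / (8 * real d))"
      using d powr_mono'[of "1 / (8 * real d)" 1 "1 / 2 :: real"] by simp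
    also have "\<dots> \<le> \<delta> powr (1 / (8 * real d))" using False by (intro powr_mono2) auto
    finally have "1 * (1 / 2) \<le> ?R" using K1 by (intro mult_mono) auto
    then show ?thesis using triv by linarith
  next
    case True
    \<comment> \<open>The exponent 2/3 of \<open>K\<close> comes from interpolating with the trivial
      bound: the minimum of 1 and \<open>w\<close> is at most \<open>w powr (2 / 3)\<close>. The
      resulting exponent \<open>2 / (3 * d)\<close> of \<delta> exceeds \<open>1 / (8 * d)\<close>,
      which only helps as \<delta> is below 1.\<close>
    define w where "w = K * \<delta> powr (1 / d)"
    have w0: "w > 0" using K \<delta>0 by (simp add: w_def)
    have "w powr (2 / 3) = K powr (2 / 3) * \<delta> powr (1 / d * (2 / 3))"
      using K \<delta>0 by (simp add: w_def powr_mult powr_powr)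
    also have "\<dots> \<le> ?R"
      using True \<delta>0 d by (intro mult_left_mono powr_mono') (auto simp: field_simps)
    finally have wR: "w powr (2 / 3) \<le> ?R" .
    show ?thesis
    proof (cases "w \<le> 1")
      case False
      then have "1 \<le> w powr (2 / 3)" by (simp add: ge_one_powr_ge_zero)
      then show ?thesis using triv wR by linarith
    next
      case w1: True
      have "w \<le> w powr (2 / 3)" using w0 w1 powr_mono'[of "2 / 3" 1 w] by simp
      then have "w \<le> ?R" using wR by simp
      moreover have "sqrt \<delta> \<le> ?R"
      proof -
        have "sqrt \<delta> = \<delta> powr (1 / 2)" using \<delta>0 by (simp add: powr_half_sqrt)
        also have "\<dots> \<le> \<delta> powr (1 / (8 * real d))"
          using True \<delta>0 d by (intro powr_mono') (auto simp: field_simps)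
        also have "\<dots> \<le> ?R" using K1 by (simp add: mult_le_cancel_right1)
        finally show ?thesis .
      qed
      moreover have "?E \<le> 2 * w + 7 * sqrt \<delta>"
        unfolding w_def using N True
        by (intro Sidon_Lipschitz_average[OF d K F Lip N S]) (auto simp: \<delta>_def powr_half_sqrt)
      ultimately show ?thesis by linarith
    qed
  qed
  then show "?E \<le> 9 * K powr (2 / 3) *
      (\<bar>real (card S) / real N powr (1 / 2) - 1\<bar> + real N powr (- 1 / 6)) powr (1 / (8 * real d))"
    by (simp add: \<delta>_def mult.assoc)
qed

end
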